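(* Let $2<a\le\infty$, let $\psi$ be a continuous positive function on $[2,a)$ with $\inf\psi>0$, and put $\psi_I(p)=K_I(p)\psi(p)$. Let $\eta=\eta(1)$ be a centered $d$-dimensional random vector from the space $G\psi^{(d)}$, let $\eta(2),\eta(3),\dots$ be independent copies of $\eta$ (so that $\eta(1),\eta(2),\dots$ are i.i.d.), and let $$\zeta(n)=n^{-1/2}\sum_{j=1}^n\eta(j).$$ Then $$\sup_n\|\zeta(n)\|_{G\psi_I^{(d)}}\le\|\eta\|_{G\psi^{(d)}}.$$
   Context: $|\eta|_p=(\mathbf{E}|\eta|^p)^{1/p}$. For a positive function $\psi$ on $[2,a)$ and a random variable $\tau$, $\|\tau\|_{G\psi}=\sup_{2\le p<a}|\tau|_p/\psi(p)$. For a random vector, $\|\xi\|_{G\psi^{(d)}}=\sup_{b\in\mathbb{R}^d,\,|b|_2\le1}\|(\xi,b)\|_{G\psi}$, and $G\psi^{(d)}$ is the space of random vectors with finite norm. For $p\ge2$, $K_I(p)$ is the optimal (smallest) constant such that, for all sequences of centered independent random variables $\{\theta(i)\}$, $$\sup_n\ \sup_{b\in\mathbb{R}^n,\ \sum b(i)^2\le1}\Big|\sum_{i=1}^n b(i)\theta(i)\Big|_p\le K_I(p)\sup_i|\theta(i)|_p .$$ It is known that $K_I(p)\le0.87\,p/\log p$ for $p\ge2$. *)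

theory Defs
  imports "HOL-Probability.Probability"
begin

text \<open>The moment norm $|X|_p = (E |X|^p)^{1/p}$ of a real random variable, with values in
  $[0,\infty]$; it is infinite when the $p$-th absolute moment is.\<close>

definition Lp_norm :: "'w measure \<Rightarrow> real \<Rightarrow> ('w \<Rightarrow> real) \<Rightarrow> ennreal" where
  "Lp_norm M p X =
     (if integrable M (\<lambda>x. \<bar>X x\<bar> powr p)
      then ennreal ((\<integral>x. \<bar>X x\<bar> powr p \<partial>M) powr (1 / p)) else \<infinity>)"

definition centered :: "'w measure \<Rightarrow> ('w \<Rightarrow> 'b::{banach,second_countable_topology}) \<Rightarrow> bool" where
  "centered M X \<longleftrightarrow> integrable M X \<and> (\<integral>x. X x \<partial>M) = 0"

definition exponents :: "ereal \<Rightarrow> real set" where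
  "exponents a = {p. 2 \<le> p \<and> ereal p < a}"

definition GPsi_norm :: "'w measure \<Rightarrow> ereal \<Rightarrow> (real \<Rightarrow> ennreal) \<Rightarrow> ('w \<Rightarrow> real) \<Rightarrow> ennreal" where
  "GPsi_norm M a \<psi> \<tau> = (SUP p\<in>exponents a. Lp_norm M p \<tau> / \<psi> p)"

definition GPsi_norm_vec ::
    "'w measure \<Rightarrow> ereal \<Rightarrow> (real \<Rightarrow> ennreal) \<Rightarrow> ('w \<Rightarrow> real ^ 'd) \<Rightarrow> ennreal" where
  "GPsi_norm_vec M a \<psi> \<xi> =
     (SUP b\<in>{b :: real ^ 'd. norm b \<le> 1}. GPsi_norm M a \<psi> (\<lambda>x. \<xi> x \<bullet> b))"

definition GPsi_space_vec ::
    "'w measure \<Rightarrow> ereal \<Rightarrow> (real \<Rightarrow> ennreal) \<Rightarrow> ('w \<Rightarrow> real ^ 'd) set" where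
  "GPsi_space_vec M a \<psi> = {\<xi> \<in> borel_measurable M. GPsi_norm_vec M a \<psi> \<xi> < \<infinity>}"

text \<open>The optimal constant is the infimum, in $[0,\infty]$, of all admissible constants. A
  definition cannot quantify over all types of sample points, so the sample space is taken to be
  \<^typ>\<open>nat \<Rightarrow> real\<close> with an arbitrary sigma-algebra and probability measure. This loses no
  generality: both sides of the inequality depend only on the joint law of the sequence, and each
  joint law is realised there by the coordinate functions.\<close>

definition K_I :: "real \<Rightarrow> ennreal" where
  "K_I p = Inf {C. \<forall>(M :: (nat \<Rightarrow> real) measure) \<theta> :: nat \<Rightarrow> (nat \<Rightarrow> real) \<Rightarrow> real.
     prob_space M \<longrightarrow>
     prob_space.indep_vars M (\<lambda>_. borel) \<theta> {1..} \<longrightarrow>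
     (\<forall>i\<ge>1. centered M (\<theta> i)) \<longrightarrow>
     (SUP n\<in>{1..}. SUP b\<in>{b :: nat \<Rightarrow> real. (\<Sum>i=1..n. (b i)\<^sup>2) \<le> 1}.
        Lp_norm M p (\<lambda>x. \<Sum>i=1..n. b i * \<theta> i x))
       \<le> C * (SUP i\<in>{1..}. Lp_norm M p (\<theta> i))}"

definition normalized_sum :: "(nat \<Rightarrow> 'w \<Rightarrow> real ^ 'd) \<Rightarrow> nat \<Rightarrow> 'w \<Rightarrow> real ^ 'd" where
  "normalized_sum \<eta> n x = (1 / sqrt (real n)) *\<^sub>R (\<Sum>j=1..n. \<eta> j x)"

end

theory Submission
  imports Defs
begin

text \<open>For a unit vector \<open>b\<close>, the scalars \<open>\<eta>(j) \<bullet> b\<close> are i.i.d. and centered, and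
  \<open>\<zeta>(n) \<bullet> b\<close> is their combination with coefficients \<open>n\<^sup>-\<^sup>1\<^sup>/\<^sup>2\<close>, so the defining inequality of \<open>K_I\<close>
  applies for each \<open>p\<close>. Passing to the infimum in that inequality needs
  \<open>|\<eta>(1) \<bullet> b|\<^sub>p < \<infinity>\<close>: for an infinite moment norm, \<open>0 \<cdot> \<infinity> = 0\<close> would break it.\<close>

lemma Lp_norm_distr:
  assumes [measurable]: "f \<in> measurable M N" "g \<in> borel_measurable N"
  shows "Lp_norm (distr M N f) p g = Lp_norm M p (\<lambda>x. g (f x))"
  unfolding Lp_norm_def by (simp add: integrable_distr_eq integral_distr)

lemma centered_distr:
  assumes "f \<in> measurable M N" "g \<in> borel_measurable N"
  shows "centered (distr M N f) g \<longleftrightarrow> centered M (\<lambda>x. g (f x))"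
  using assms unfolding centered_def by (simp add: integrable_distr_eq integral_distr)

text \<open>For nonempty \<open>I\<close>, independence means that the joint law is the product of
  the marginals. The joint law and the marginals of \<open>Y\<close> under the image measure are
  those of \<open>Y i (f x)\<close> under \<open>M\<close>.\<close>

lemma (in prob_space) indep_vars_distr:
  assumes f: "f \<in> measurable M N"
    and Y: "\<And>i. i \<in> I \<Longrightarrow> Y i \<in> measurable N (M' i)"
    and indep: "indep_vars M' (\<lambda>i x. Y i (f x)) I"
    and "I \<noteq> {}"
  shows "prob_space.indep_vars (distr M N f) M' Y I"
proof -
  interpret N: prob_space "distr M N f"
    using f by (rule prob_space_distr)
  have Yf: "random_variable (M' i) (\<lambda>x. Y i (f x))" if "i \<in> I" for i
    using measurable_compose[OF f Y[OF that]] .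
  have "distr (distr M N f) (\<Pi>\<^sub>M i\<in>I. M' i) (\<lambda>x. \<lambda>i\<in>I. Y i x)
      = distr M (\<Pi>\<^sub>M i\<in>I. M' i) (\<lambda>x. \<lambda>i\<in>I. Y i (f x))"
    using Y by (subst distr_distr[OF _ f]) (auto intro!: measurable_restrict simp: comp_def)
  also have "\<dots> = (\<Pi>\<^sub>M i\<in>I. distr M (M' i) (\<lambda>x. Y i (f x)))"
    using indep Yf by (intro iffD1[OF indep_vars_iff_distr_eq_PiM'] \<open>I \<noteq> {}\<close>)
  also have "\<dots> = (\<Pi>\<^sub>M i\<in>I. distr (distr M N f) (M' i) (Y i))"
    using Y by (intro PiM_cong) (auto simp: distr_distr[OF _ f] comp_def)
  finally show ?thesis
    using Y by (subst N.indep_vars_iff_distr_eq_PiM'[OF \<open>I \<noteq> {}\<close>]) auto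
qed

lemma le_Inf_mult_ennreal:
  fixes L S :: ennreal
  assumes "\<And>C. C \<in> A \<Longrightarrow> L \<le> C * S" "S < \<infinity>" "Inf A < \<infinity>"
  shows "L \<le> Inf A * S"
proof (cases "S = 0")
  case True
  \<comment> \<open>The infimum of the empty set is \<infinity>, so some \<open>C\<close> lies in
    \<open>A\<close>, and then \<open>L \<le> C * 0 = 0\<close>.\<close>
  have "A \<noteq> {}"
    using assms(3) by auto
  then show ?thesis
    using assms(1) True by auto
next
  case False
  \<comment> \<open>Division by \<open>S\<close> turns every bound \<open>L \<le> C * S\<close> into
    a lower bound of \<open>A\<close>; finiteness of \<open>S\<close> later allows multiplying
    back.\<close>
  have "L / S \<le> Inf A"
    using False assms(1)
    by (intro Inf_greatest divide_le_posI_ennreal) (auto simp: mult.commute zero_less_iff_neq_zero)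
  then have "L / S * S \<le> Inf A * S"
    by (rule mult_right_mono) simp
  then show ?thesis
    using False assms(2) by (simp add: ennreal_divide_times)
qed

text \<open>\<open>K_I\<close> ranges only over sample spaces of type
  \<open>nat \<Rightarrow> real\<close>. An arbitrary sample space is reached by replacing the
  sequence with the coordinate functions under its joint law, which keeps independence, centering
  and moments.\<close>

lemma (in prob_space) Lp_norm_sum_le_K_I:
  fixes X :: "nat \<Rightarrow> 'a \<Rightarrow> real"
  assumes indep: "indep_vars (\<lambda>_. borel) X {1..}"
    and cent: "\<And>i. i \<ge> 1 \<Longrightarrow> centered M (X i)"
    and S: "(SUP i\<in>{1..}. Lp_norm M p (X i)) < \<infinity>"
    and K: "K_I p < \<infinity>"
    and "n \<ge> 1" "(\<Sum>i=1..n. (b i)\<^sup>2) \<le> 1"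
  shows "Lp_norm M p (\<lambda>x. \<Sum>i=1..n. b i * X i x) \<le> K_I p * (SUP i\<in>{1..}. Lp_norm M p (X i))"
    (is "?L \<le> _ * ?S")
proof -
  \<comment> \<open>\<^term>\<open>X 0\<close> need not be measurable, so the joint law is formed with the 0-th coordinate set to 0.\<close>
  define f where "f x i = (if i \<ge> 1 then X i x else 0)" for x and i :: nat
  define N :: "(nat \<Rightarrow> real) measure" where "N = (\<Pi>\<^sub>M i\<in>UNIV. borel)"
  let ?\<theta> = "\<lambda>(i::nat) (\<omega>::nat \<Rightarrow> real). \<omega> i"
  have rv: "X i \<in> borel_measurable M" if "i \<ge> 1" for i
    using indep that by (auto simp: indep_vars_def)
  have f: "f \<in> measurable M N"
    unfolding N_def f_def
  proof (rule measurable_PiM_single')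
    show "random_variable borel (\<lambda>x. if i \<ge> 1 then X i x else 0)" for i :: nat
      using rv[of i] by (cases "i \<ge> 1") simp_all
  qed auto
  have \<theta>[measurable]: "?\<theta> i \<in> borel_measurable N" for i
    unfolding N_def by (rule measurable_component_singleton) simp
  have fX: "(\<lambda>x. f x i) = X i" if "i \<ge> 1" for i
    using that by (auto simp: f_def)
  have prob: "prob_space (distr M N f)"
    using f by (rule prob_space_distr)
  have "indep_vars (\<lambda>_. borel) (\<lambda>i x. f x i) {1..} \<longleftrightarrow> indep_vars (\<lambda>_. borel) X {1..}"
    by (rule indep_vars_cong) (auto simp: fX)
  then have indep': "prob_space.indep_vars (distr M N f) (\<lambda>_. borel) ?\<theta> {1..}"
    using indep by (intro indep_vars_distr[OF f]) auto
  have cent': "\<forall>i\<ge>1. centered (distr M N f) (?\<theta> i)"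
    using cent by (simp add: centered_distr[OF f \<theta>] fX)
  have S': "(SUP i\<in>{1..}. Lp_norm (distr M N f) p (?\<theta> i)) = ?S"
    by (intro SUP_cong) (simp_all add: Lp_norm_distr[OF f \<theta>] fX)
  have "Lp_norm (distr M N f) p (\<lambda>\<omega>. \<Sum>i=1..n. b i * ?\<theta> i \<omega>)
      = Lp_norm M p (\<lambda>x. \<Sum>i=1..n. b i * f x i)"
    by (rule Lp_norm_distr[OF f]) measurable
  also have "\<dots> = ?L"
    by (auto simp: f_def intro!: arg_cong[where f = "Lp_norm M p"] sum.cong)
  finally have L': "Lp_norm (distr M N f) p (\<lambda>\<omega>. \<Sum>i=1..n. b i * ?\<theta> i \<omega>) = ?L" .
  show ?thesis
    unfolding K_I_def
  proof (rule le_Inf_mult_ennreal)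
    fix C
    assume "C \<in> {C. \<forall>(M :: (nat \<Rightarrow> real) measure) \<theta> :: nat \<Rightarrow> (nat \<Rightarrow> real) \<Rightarrow> real.
     prob_space M \<longrightarrow>
     prob_space.indep_vars M (\<lambda>_. borel) \<theta> {1..} \<longrightarrow>
     (\<forall>i\<ge>1. centered M (\<theta> i)) \<longrightarrow>
     (SUP n\<in>{1..}. SUP b\<in>{b :: nat \<Rightarrow> real. (\<Sum>i=1..n. (b i)\<^sup>2) \<le> 1}.
        Lp_norm M p (\<lambda>x. \<Sum>i=1..n. b i * \<theta> i x))
       \<le> C * (SUP i\<in>{1..}. Lp_norm M p (\<theta> i))}"
    \<comment> \<open>Admissibility of \<open>C\<close> is used for the joint law
      \<open>distr M N f\<close> and its coordinates.\<close>
    then have "(SUP n\<in>{1..}. SUP b\<in>{b :: nat \<Rightarrow> real. (\<Sum>i=1..n. (b i)\<^sup>2) \<le> 1}.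
        Lp_norm (distr M N f) p (\<lambda>\<omega>. \<Sum>i=1..n. b i * ?\<theta> i \<omega>)) \<le> C * ?S"
      unfolding mem_Collect_eq S'[symmetric] using prob indep' cent' by blast
    then show "?L \<le> C * ?S"
      unfolding SUP_le_iff L'[symmetric] using assms(5,6) by auto
  qed (use S K in \<open>simp_all add: K_I_def\<close>)
qed

theorem proposition5p3:
  fixes M :: "'w measure"
    and a :: ereal
    and \<psi> :: "real \<Rightarrow> real"
    and \<eta> :: "nat \<Rightarrow> 'w \<Rightarrow> real ^ 'd"
  assumes "prob_space M"
    and "2 < a"
    and "continuous_on (exponents a) \<psi>"
    and "\<forall>p\<in>exponents a. 0 < \<psi> p"
    and "0 < (INF p\<in>exponents a. \<psi> p)"
    and "centered M (\<eta> 1)"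
    and "\<eta> 1 \<in> GPsi_space_vec M a (\<lambda>p. ennreal (\<psi> p))"
    and "prob_space.indep_vars M (\<lambda>_. borel) \<eta> {1..}"
    and "\<forall>j\<ge>1. distr M borel (\<eta> j) = distr M borel (\<eta> 1)"
  shows "(SUP n\<in>{1..}. GPsi_norm_vec M a (\<lambda>p. K_I p * ennreal (\<psi> p)) (normalized_sum \<eta> n))
           \<le> GPsi_norm_vec M a (\<lambda>p. ennreal (\<psi> p)) (\<eta> 1)"
proof -
  interpret prob_space M by fact
  have rv: "\<eta> j \<in> borel_measurable M" if "j \<ge> 1" for j
    using assms(8) that by (auto simp: indep_vars_def)
  have main: "Lp_norm M p (\<lambda>x. normalized_sum \<eta> n x \<bullet> b) / (K_I p * ennreal (\<psi> p))
      \<le> GPsi_norm_vec M a (\<lambda>p. ennreal (\<psi> p)) (\<eta> 1)" (is "?L / _ \<le> ?R")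
    if n: "n \<ge> 1" and b: "norm b \<le> 1" and p: "p \<in> exponents a" for n b p
  proof (cases "K_I p < \<infinity>")
    case False
    \<comment> \<open>The denominator is then infinite, and a quotient by \<infinity> is 0 in
      \<open>ennreal\<close>, even for an infinite numerator.\<close>
    moreover have "ennreal (\<psi> p) \<noteq> 0"
      using assms(4) p by auto
    ultimately show ?thesis
      by (simp add: ennreal_top_mult not_less top_unique)
  next
    case K: True
    define X where "X j x = \<eta> j x \<bullet> b" for j x
    define S where "S = Lp_norm M p (X 1)"
    have S_le: "S / ennreal (\<psi> p) \<le> ?R"
      unfolding GPsi_norm_vec_def GPsi_norm_def S_def X_def
      using b p by (auto intro!: SUP_upper2[of b] SUP_upper2[of p])
    also have "\<dots> < \<infinity>"
      using assms(7) by (simp add: GPsi_space_vec_def)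
    \<comment> \<open>\<open>ennreal (\<psi> p)\<close> is finite, so an infinite \<open>S\<close>
      would make the quotient infinite.\<close>
    finally have S_fin: "S < \<infinity>"
      by (cases "S = top") (auto simp: ennreal_top_divide less_top)
    \<comment> \<open>Both properties depend only on the law of \<open>\<eta> j\<close>, which is
      that of \<open>\<eta> 1\<close>.\<close>
    have eq: "Lp_norm M p (X j) = S" and cent: "centered M (X j)" if "j \<ge> 1" for j
    proof -
      have m: "(\<lambda>v. v \<bullet> b) \<in> borel_measurable borel"
        by measurable
      note same = assms(9)[rule_format, OF that]
      show "Lp_norm M p (X j) = S"
        using Lp_norm_distr[OF rv[OF that] m, of p, unfolded same]
          Lp_norm_distr[OF rv[OF order_refl] m, of p]
        unfolding X_def S_def by (simp only:)
      have "centered M (X 1)"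
        using assms(6) unfolding X_def centered_def by simp
      then show "centered M (X j)"
        using centered_distr[OF rv[OF that] m, unfolded same]
          centered_distr[OF rv[OF order_refl] m]
        unfolding X_def by (simp only:)
    qed
    have Sup: "(SUP i\<in>{1..}. Lp_norm M p (X i)) = S"
      using eq by (subst SUP_cong[OF refl, of _ _ "\<lambda>_. S"]) auto
    have indep: "indep_vars (\<lambda>_. borel) X {1..}"
      unfolding X_def by (rule indep_vars_compose2[OF assms(8)]) measurable
    have "?L = Lp_norm M p (\<lambda>x. \<Sum>i=1..n. 1 / sqrt n * X i x)"
      by (simp add: normalized_sum_def X_def inner_sum_left sum_distrib_left sum_divide_distrib)
    also have "\<dots> \<le> K_I p * S"
      \<comment> \<open>The squares of the \<open>n\<close> coefficients \<open>1 / sqrt n\<close>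
        sum to exactly 1.\<close>
      using Lp_norm_sum_le_K_I[OF indep cent _ K n, of "\<lambda>_. 1 / sqrt n"] Sup S_fin n
      by (simp add: power_divide)
    finally have L: "?L \<le> K_I p * S" .
    show ?thesis
    proof (cases "K_I p = 0")
      case True
      \<comment> \<open>Here \<open>L\<close> forces the numerator to be 0, and
        \<open>0 / 0 = 0\<close> in \<open>ennreal\<close>. Cancelling \<open>K_I p\<close>, as in
        the other case, requires it to be nonzero and finite.\<close>
      then show ?thesis
        using L by simp
    next
      case False
      have "?L / (K_I p * ennreal (\<psi> p)) \<le> (S * K_I p) / (ennreal (\<psi> p) * K_I p)"
        using L by (simp add: divide_right_mono_ennreal mult.commute)
      also have "\<dots> = S / ennreal (\<psi> p)"
        using False K by (intro divide_mult_eq) auto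
      finally show ?thesis
        using S_le by simp
    qed
  qed
  show ?thesis
    unfolding GPsi_norm_vec_def[of M a "\<lambda>p. K_I p * ennreal (\<psi> p)"]
      GPsi_norm_def[of M a "\<lambda>p. K_I p * ennreal (\<psi> p)"]
    by (intro SUP_least) (use main in auto)
qed

end
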